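(* For every linear decaying stochastic depletion problem, for all $\bar s\in\mathcal S$ and all $\alpha\in\prod_{m=1}^M\{0,1,\dots,x(\bar s)_m\}$, $$J^*(\bar s)\le\sum_{m=1}^M\alpha_m\,w_{m,t(\bar s)}+J^*\big(\tilde S_\alpha(\bar s)\big).$$
   Context: Linear decaying stochastic depletion problem (clairvoyant form). There are $M$ item types, with at most $\bar x_m\in\mathbb Z_+$ items of type $m$; a finite nonempty set $\mathcal A$ of activities; a horizon $T$ (a positive integer); and, for each $A\in\mathcal A$, a fixed known sequence $P_t(A)=(P_{t,1}(A),\dots,P_{t,M}(A))\in[0,1]^M$, $t=0,1,2,\dots$. The state space is $\mathcal S=\{(x,t): x\in\prod_{m}\{0,\dots,\bar x_m\},\ t\in\{0,\dots,T\}\}$; for $s=(x,t)$ write $x(s)=x$, $t(s)=t$. If activity $A$ is used in state $s=(x,t)$ with $t<T$, a random vector $X_t=(X_{t,m})_m$ of items is depleted, where the $X_{t,m}$ are independent of each other and (given $x$ and $P_t(A)$) of the past, and $X_{t,m}\sim\mathrm{Binomial}(x_m,P_{t,m}(A))$. The next state is $(x-X_t,t+1)$ and the reward earned is $R(s,A)=\sum_m w_{m,t}X_{t,m}$, where for each $m$, $w_{m,t}$ is a non-negative, non-increasing function of $t\in\{0,\dots,T\}$. A policy is a map $\pi:\mathcal S\to\mathcal A$; $J^\pi(s)=E\big[\sum_{t'=t(s)}^{T-1}R(S_{t'},\pi(S_{t'}))\mid S_{t(s)}=s\big]$, where $S_t$ is the state at time $t$ under $\pi$, and $J^*(s)=\max_\pi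 J^\pi(s)$. For $\alpha\in\mathbb Z_+^M$, $\tilde S_\alpha(s)$ is the state $s'$ with $t(s')=t(s)$ and $x(s')_m=\max(x(s)_m-\alpha_m,0)$ for all $m$. *)

theory Defs
  imports "HOL-Probability.Product_PMF"
begin

text \<open>
  The \<open>M\<close> item types are the elements of a finite type \<open>'m\<close>; activities form a subset of a type
  \<open>'a\<close>. A state is a pair \<open>(x, t)\<close> of remaining item counts and time.
\<close>

record ('m, 'a) depletion_data =
  capacity :: "'m \<Rightarrow> nat"
  activities :: "'a set"
  horizon :: nat
  depl_prob :: "nat \<Rightarrow> 'a \<Rightarrow> 'm \<Rightarrow> real"
  weight :: "'m \<Rightarrow> nat \<Rightarrow> real"

type_synonym 'm state = "('m \<Rightarrow> nat) \<times> nat"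

definition linear_decaying_problem :: "('m::finite, 'a) depletion_data \<Rightarrow> bool" where
  "linear_decaying_problem D \<longleftrightarrow>
     finite (activities D) \<and> activities D \<noteq> {} \<and>
     horizon D > 0 \<and>
     (\<forall>t. \<forall>A\<in>activities D. \<forall>m. depl_prob D t A m \<in> {0..1}) \<and>
     (\<forall>m. \<forall>t\<in>{0..horizon D}. weight D m t \<ge> 0) \<and>
     (\<forall>m. antimono_on {0..horizon D} (weight D m))"

definition states :: "('m::finite, 'a) depletion_data \<Rightarrow> 'm state set" where
  "states D = {(x, t). (\<forall>m. x m \<le> capacity D m) \<and> t \<le> horizon D}"

definition depletion_pmf ::
  "('m::finite, 'a) depletion_data \<Rightarrow> 'm state \<Rightarrow> 'a \<Rightarrow> ('m \<Rightarrow> nat) pmf" where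
  "depletion_pmf D s A =
     Pi_pmf UNIV 0 (\<lambda>m. binomial_pmf (fst s m) (depl_prob D (snd s) A m))"

definition next_state :: "'m state \<Rightarrow> ('m \<Rightarrow> nat) \<Rightarrow> 'm state" where
  "next_state s X = (\<lambda>m. fst s m - X m, snd s + 1)"

definition reward :: "('m::finite, 'a) depletion_data \<Rightarrow> 'm state \<Rightarrow> ('m \<Rightarrow> nat) \<Rightarrow> real" where
  "reward D s X = (\<Sum>m\<in>UNIV. weight D m (snd s) * real (X m))"

text \<open>
  Joint law of the first \<open>n\<close> pairs (visited state, items depleted there) of the process started
  in \<open>s\<close> and controlled by the policy \<open>\<pi>\<close>.
\<close>

primrec trajectory ::
  "('m::finite, 'a) depletion_data \<Rightarrow> ('m state \<Rightarrow> 'a) \<Rightarrow> nat \<Rightarrow> 'm state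
    \<Rightarrow> ('m state \<times> ('m \<Rightarrow> nat)) list pmf" where
  "trajectory D \<pi> 0 s = return_pmf []"
| "trajectory D \<pi> (Suc n) s =
     bind_pmf (depletion_pmf D s (\<pi> s))
       (\<lambda>X. map_pmf (\<lambda>h. (s, X) # h) (trajectory D \<pi> n (next_state s X)))"

definition policies :: "('m::finite, 'a) depletion_data \<Rightarrow> ('m state \<Rightarrow> 'a) set" where
  "policies D = states D \<rightarrow>\<^sub>E activities D"

definition J :: "('m::finite, 'a) depletion_data \<Rightarrow> ('m state \<Rightarrow> 'a) \<Rightarrow> 'm state \<Rightarrow> real" where
  "J D \<pi> s =
     measure_pmf.expectation (trajectory D \<pi> (horizon D - snd s) s)
       (\<lambda>h. \<Sum>(s', X)\<leftarrow>h. reward D s' X)"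

text \<open>
  Policies are extensional functions on the finite set of states, so for a finite nonempty set of
  activities the maximum is over a finite nonempty set.
\<close>

definition J_opt :: "('m::finite, 'a) depletion_data \<Rightarrow> 'm state \<Rightarrow> real" where
  "J_opt D s = Max ((\<lambda>\<pi>. J D \<pi> s) ` policies D)"

text \<open>Truncated subtraction on \<open>nat\<close> plays the role of \<open>max (x m - \<alpha> m) 0\<close>.\<close>

definition reduced_state :: "('m \<Rightarrow> nat) \<Rightarrow> 'm state \<Rightarrow> 'm state" where
  "reduced_state \<alpha> s = (\<lambda>m. fst s m - \<alpha> m, snd s)"

end

theory Submission imports Defs begin

text \<open>
  By dynamic programming, \<open>J_opt\<close> is the value function of the Bellman recursion
  (\<open>J_opt_eq_opt_value\<close>), so it suffices to bound that recursion. This goes by induction on the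
  number of remaining periods (\<open>opt_value_le_reduced\<close>). A binomial number of successes among
  \<open>x m\<close> items splits into independent binomial numbers \<open>Y m\<close> among \<open>x m - \<alpha> m\<close> items and
  \<open>Z m\<close> among the \<open>\<alpha> m\<close> others (\<open>depletion_pmf_split\<close>). With any fixed activity, the process
  started in \<open>x\<close> therefore moves to \<open>x - Y - Z\<close>, while the process started in \<open>x - \<alpha>\<close> can be
  coupled to it so as to move to \<open>x - \<alpha> - Y\<close>, which is \<open>x - Y - Z\<close> with \<open>\<alpha> - Z\<close> further items
  removed. By the induction hypothesis the values from there on differ by at most
  \<open>\<Sum>m. (\<alpha> m - Z m) w\<^sub>m\<^sub>,\<^sub>t\<^sub>+\<^sub>1\<close>, and the present rewards differ by \<open>\<Sum>m. Z m w\<^sub>m\<^sub>,\<^sub>t\<close>. As weights do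
  not increase in time, the sum of the two is at most \<open>\<Sum>m. \<alpha> m w\<^sub>m\<^sub>,\<^sub>t\<close>.
\<close>

section \<open>Finitely supported distributions and binomial splitting\<close>

lemma expectation_bind_pmf_finite:
  fixes h :: "'b \<Rightarrow> real"
  assumes "finite (set_pmf p)" "\<And>x. x \<in> set_pmf p \<Longrightarrow> finite (set_pmf (f x))"
  shows "measure_pmf.expectation (bind_pmf p f) h =
           measure_pmf.expectation p (\<lambda>x. measure_pmf.expectation (f x) h)"
  using assms
  by (subst pmf_expectation_bind[of "set_pmf p"])
     (auto simp: integral_measure_pmf[of "set_pmf p"])

lemma expectation_mono_pmf_finite:
  fixes f g :: "'b \<Rightarrow> real"
  assumes "finite (set_pmf p)" "\<And>x. x \<in> set_pmf p \<Longrightarrow> f x \<le> g x"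
  shows "measure_pmf.expectation p f \<le> measure_pmf.expectation p g"
  using assms by (intro integral_mono_AE integrable_measure_pmf_finite AE_pmfI) auto

lemma expectation_cong_pmf:
  fixes f g :: "'b \<Rightarrow> real"
  assumes "\<And>x. x \<in> set_pmf p \<Longrightarrow> f x = g x"
  shows "measure_pmf.expectation p f = measure_pmf.expectation p g"
  using assms by (intro integral_cong_AE AE_pmfI) auto

lemma binomial_pmf_add:
  assumes "p \<in> {0..1}"
  shows "binomial_pmf (a + b) p =
           bind_pmf (binomial_pmf a p) (\<lambda>y. bind_pmf (binomial_pmf b p) (\<lambda>z. return_pmf (y + z)))"
proof (induction a)
  case 0
  then show ?case
    using assms by (simp add: binomial_pmf_0 bind_return_pmf bind_return_pmf')
next
  case (Suc a)
  then show ?case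
    using assms
    by (simp add: binomial_pmf_Suc bind_assoc_pmf bind_return_pmf add.assoc)
qed

lemma set_pmf_binomial_le:
  assumes "p \<in> {0..1}" "k \<in> set_pmf (binomial_pmf n p)"
  shows "k \<le> n"
  using assms by (auto simp: set_pmf_binomial_eq split: if_splits)

section \<open>Depletion in one period\<close>

lemma depl_prob_bounds:
  "linear_decaying_problem D \<Longrightarrow> A \<in> activities D \<Longrightarrow> depl_prob D t A m \<in> {0..1}"
  by (auto simp: linear_decaying_problem_def)

lemma finite_set_depletion_pmf:
  assumes "linear_decaying_problem D" "A \<in> activities D"
  shows "finite (set_pmf (depletion_pmf D s A))"
  unfolding depletion_pmf_def
  by (rule finite_subset[OF set_Pi_pmf_subset'])
     (auto intro!: finite_PiE_dflt finite_set_pmf_binomial_pmf depl_prob_bounds assms)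

lemma set_depletion_pmf_le:
  assumes "linear_decaying_problem D" "A \<in> activities D" "X \<in> set_pmf (depletion_pmf D s A)"
  shows "X m \<le> fst s m"
proof (rule set_pmf_binomial_le[OF depl_prob_bounds[OF assms(1,2)]])
  show "X m \<in> set_pmf (binomial_pmf (fst s m) (depl_prob D (snd s) A m))"
    using assms(3) by (auto simp: depletion_pmf_def set_Pi_pmf PiE_dflt_def)
qed

text \<open>
  The items \<open>\<alpha>\<close> are depleted independently of the remaining ones, with the law of a state that
  holds exactly the items \<open>\<alpha>\<close>.
\<close>

lemma depletion_pmf_split:
  assumes "linear_decaying_problem D" "A \<in> activities D" "\<And>m. \<alpha> m \<le> fst s m"
  shows "depletion_pmf D s A =
           bind_pmf (depletion_pmf D (reduced_state \<alpha> s) A)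
             (\<lambda>Y. map_pmf (\<lambda>Z m. Y m + Z m) (depletion_pmf D (\<alpha>, snd s) A))"
proof -
  let ?p = "depl_prob D (snd s) A"
  have "binomial_pmf (fst s m) (?p m) =
      bind_pmf (binomial_pmf (fst s m - \<alpha> m) (?p m))
        (\<lambda>y. bind_pmf (binomial_pmf (\<alpha> m) (?p m)) (\<lambda>z. return_pmf (y + z)))" for m
    using binomial_pmf_add[OF depl_prob_bounds[OF assms(1,2)],
        of "fst s m - \<alpha> m" "\<alpha> m" "snd s" m] assms(3)[of m]
    by simp
  then show ?thesis
    unfolding depletion_pmf_def reduced_state_def
    by (simp add: Pi_pmf_bind[where d' = 0] map_pmf_def)
qed

lemma next_state_in_states:
  assumes "s \<in> states D" "snd s < horizon D"
  shows "next_state s X \<in> states D"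
  using assms by (auto simp: states_def next_state_def intro: le_trans[OF diff_le_self])

section \<open>The Bellman recursion\<close>

text \<open>
  Optimal expected reward over the next \<open>n\<close> periods, by backward recursion on \<open>n\<close>. The time
  index of the state is not consulted to stop, so \<open>n\<close> is meant to be \<open>horizon D - snd s\<close>.
\<close>

primrec opt_value :: "('m::finite, 'a) depletion_data \<Rightarrow> nat \<Rightarrow> 'm state \<Rightarrow> real" where
  "opt_value D 0 s = 0"
| "opt_value D (Suc n) s =
     Max ((\<lambda>A. measure_pmf.expectation (depletion_pmf D s A)
                 (\<lambda>X. reward D s X + opt_value D n (next_state s X))) ` activities D)"

lemma opt_value_Suc_ge:
  assumes "linear_decaying_problem D" "A \<in> activities D"
  shows "measure_pmf.expectation (depletion_pmf D s A)
           (\<lambda>X. reward D s X + opt_value D n (next_state s X)) \<le> opt_value D (Suc n) s"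
  using assms by (auto simp: linear_decaying_problem_def)

lemma opt_value_Suc_attained:
  assumes "linear_decaying_problem D"
  obtains A where "A \<in> activities D"
    "opt_value D (Suc n) s = measure_pmf.expectation (depletion_pmf D s A)
       (\<lambda>X. reward D s X + opt_value D n (next_state s X))"
proof -
  have "opt_value D (Suc n) s \<in> (\<lambda>A. measure_pmf.expectation (depletion_pmf D s A)
      (\<lambda>X. reward D s X + opt_value D n (next_state s X))) ` activities D"
    unfolding opt_value.simps
    by (rule Max_in) (use assms in \<open>auto simp: linear_decaying_problem_def\<close>)
  then show ?thesis using that by blast
qed

text \<open>
  The induction hypothesis is applied to the successor state with the surviving part
  \<open>\<alpha> - Z\<close> of the removed items.
\<close>

lemma opt_value_le_reduced:
  assumes D: "linear_decaying_problem D"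
    and "n + snd s = horizon D" "\<And>m. \<alpha> m \<le> fst s m"
  shows "opt_value D n s \<le>
           (\<Sum>m\<in>UNIV. real (\<alpha> m) * weight D m (snd s)) + opt_value D n (reduced_state \<alpha> s)"
  using assms(2,3)
proof (induction n arbitrary: s \<alpha>)
  case 0
  then show ?case
    using D by (auto simp: linear_decaying_problem_def intro!: sum_nonneg mult_nonneg_nonneg)
next
  case (Suc n)
  let ?r = "reduced_state \<alpha> s"
  let ?c = "\<Sum>m\<in>UNIV. real (\<alpha> m) * weight D m (snd s)"
  let ?F = "\<lambda>s X. reward D s X + opt_value D n (next_state s X)"
  obtain A where A: "A \<in> activities D"
    and opt: "opt_value D (Suc n) s = measure_pmf.expectation (depletion_pmf D s A) (?F s)"
    using opt_value_Suc_attained[OF D] by blast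
  let ?Y = "depletion_pmf D ?r A" and ?Z = "depletion_pmf D (\<alpha>, snd s) A"
  have weight_dec: "weight D m (Suc (snd s)) \<le> weight D m (snd s)" for m
  proof -
    have "antimono_on {0..horizon D} (weight D m)"
      using D by (auto simp: linear_decaying_problem_def)
    then show ?thesis
      by (rule monotone_onD) (use Suc.prems(1) in auto)
  qed
  have coupled: "?F s (\<lambda>m. Y m + Z m) \<le> ?c + ?F ?r Y"
    if Y: "Y \<in> set_pmf ?Y" and Z: "Z \<in> set_pmf ?Z" for Y Z
  proof -
    let ?s' = "next_state s (\<lambda>m. Y m + Z m)"
    let ?\<beta> = "\<lambda>m. \<alpha> m - Z m"
    have Yle: "Y m \<le> fst s m - \<alpha> m" for m
      using set_depletion_pmf_le[OF D A Y, of m] by (simp add: reduced_state_def)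
    have Zle: "Z m \<le> \<alpha> m" for m
      using set_depletion_pmf_le[OF D A Z, of m] by simp
    have "opt_value D n ?s' \<le>
        (\<Sum>m\<in>UNIV. real (?\<beta> m) * weight D m (snd ?s')) + opt_value D n (reduced_state ?\<beta> ?s')"
    proof (rule Suc.IH)
      show "n + snd ?s' = horizon D"
        using Suc.prems(1) by (simp add: next_state_def)
      show "?\<beta> m \<le> fst ?s' m" for m
        using Yle[of m] Zle[of m] Suc.prems(2)[of m] by (simp add: next_state_def)
    qed
    also have "reduced_state ?\<beta> ?s' = next_state ?r Y"
    proof -
      have "fst s m - (Y m + Z m) - (\<alpha> m - Z m) = fst s m - \<alpha> m - Y m" for m
        using Yle[of m] Zle[of m] Suc.prems(2)[of m] by linarith
      then show ?thesis by (simp add: reduced_state_def next_state_def)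
    qed
    also have "(\<Sum>m\<in>UNIV. real (?\<beta> m) * weight D m (snd ?s')) \<le>
        (\<Sum>m\<in>UNIV. real (?\<beta> m) * weight D m (snd s))"
      by (intro sum_mono mult_left_mono) (auto simp: next_state_def weight_dec)
    also have "(\<Sum>m\<in>UNIV. real (?\<beta> m) * weight D m (snd s)) = ?c - reward D s Z"
      using Zle by (simp add: reward_def of_nat_diff algebra_simps sum_subtractf)
    finally have "opt_value D n ?s' \<le> ?c - reward D s Z + opt_value D n (next_state ?r Y)"
      by simp
    moreover have "reward D s (\<lambda>m. Y m + Z m) = reward D ?r Y + reward D s Z"
      by (simp add: reward_def reduced_state_def algebra_simps sum.distrib)
    ultimately show ?thesis by linarith
  qed
  note fin = finite_set_depletion_pmf[OF D A]
  have "opt_value D (Suc n) s =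
      measure_pmf.expectation ?Y (\<lambda>Y. measure_pmf.expectation ?Z (\<lambda>Z. ?F s (\<lambda>m. Y m + Z m)))"
    unfolding opt
    by (subst depletion_pmf_split[OF D A Suc.prems(2)])
       (simp_all add: expectation_bind_pmf_finite fin)
  also have "\<dots> \<le> measure_pmf.expectation ?Y (\<lambda>Y. measure_pmf.expectation ?Z (\<lambda>Z. ?c + ?F ?r Y))"
    by (intro expectation_mono_pmf_finite fin coupled)
  also have "\<dots> = ?c + measure_pmf.expectation ?Y (?F ?r)"
  proof -
    have "measure_pmf.expectation ?Y (\<lambda>Y. ?c + ?F ?r Y) =
        measure_pmf.expectation ?Y (\<lambda>_. ?c) + measure_pmf.expectation ?Y (?F ?r)"
      by (intro Bochner_Integration.integral_add integrable_measure_pmf_finite fin)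
    then show ?thesis by simp
  qed
  also have "\<dots> \<le> ?c + opt_value D (Suc n) ?r"
    using opt_value_Suc_ge[OF D A] by simp
  finally show ?case .
qed

section \<open>Optimality of the Bellman recursion\<close>

lemma policy_activity:
  "\<pi> \<in> policies D \<Longrightarrow> s \<in> states D \<Longrightarrow> \<pi> s \<in> activities D"
  by (auto simp: policies_def)

lemma finite_set_trajectory:
  assumes "linear_decaying_problem D" "\<pi> \<in> policies D"
    and "s \<in> states D" "n + snd s \<le> horizon D"
  shows "finite (set_pmf (trajectory D \<pi> n s))"
  using assms(3,4)
proof (induction n arbitrary: s)
  case (Suc n)
  have "finite (set_pmf (trajectory D \<pi> n (next_state s X)))" for X
    using Suc.prems by (intro Suc.IH next_state_in_states) (auto simp: next_state_def)
  then show ?case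
    using finite_set_depletion_pmf[OF assms(1) policy_activity[OF assms(2) Suc.prems(1)]]
    by simp
qed simp

lemma J_at_horizon: "snd s = horizon D \<Longrightarrow> J D \<pi> s = 0"
  by (simp add: J_def)

lemma J_step:
  assumes D: "linear_decaying_problem D" and \<pi>: "\<pi> \<in> policies D"
    and s: "s \<in> states D" "snd s < horizon D"
  shows "J D \<pi> s = measure_pmf.expectation (depletion_pmf D s (\<pi> s))
           (\<lambda>X. reward D s X + J D \<pi> (next_state s X))"
proof -
  define n where "n = horizon D - snd s - 1"
  have n: "horizon D - snd s = Suc n" "\<And>X. horizon D - snd (next_state s X) = n"
    using s(2) by (auto simp: n_def next_state_def)
  have fin: "finite (set_pmf (trajectory D \<pi> n (next_state s X)))" for X
    using s by (intro finite_set_trajectory[OF D \<pi>] next_state_in_states)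
      (auto simp: next_state_def n_def)
  show ?thesis
    unfolding J_def n trajectory.simps
    by (subst expectation_bind_pmf_finite)
       (simp_all add: fin finite_set_depletion_pmf[OF D policy_activity[OF \<pi> s(1)]]
          Bochner_Integration.integral_add[OF integrable_measure_pmf_finite
            integrable_measure_pmf_finite])
qed

lemma J_le_opt_value:
  assumes D: "linear_decaying_problem D" and \<pi>: "\<pi> \<in> policies D"
    and "s \<in> states D" "n + snd s = horizon D"
  shows "J D \<pi> s \<le> opt_value D n s"
  using assms(3,4)
proof (induction n arbitrary: s)
  case 0
  then show ?case by (simp add: J_at_horizon)
next
  case (Suc n)
  have A: "\<pi> s \<in> activities D"
    using \<pi> Suc.prems(1) by (rule policy_activity)
  have "J D \<pi> s = measure_pmf.expectation (depletion_pmf D s (\<pi> s))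
      (\<lambda>X. reward D s X + J D \<pi> (next_state s X))"
    using Suc.prems by (intro J_step[OF D \<pi>]) auto
  also have "\<dots> \<le> measure_pmf.expectation (depletion_pmf D s (\<pi> s))
      (\<lambda>X. reward D s X + opt_value D n (next_state s X))"
    using Suc.prems
    by (intro expectation_mono_pmf_finite finite_set_depletion_pmf[OF D A] add_left_mono
        Suc.IH next_state_in_states) (auto simp: next_state_def)
  also have "\<dots> \<le> opt_value D (Suc n) s"
    by (rule opt_value_Suc_ge[OF D A])
  finally show ?case .
qed

text \<open>A policy choosing a maximising activity in each state attains the optimum from all states.\<close>

lemma greedy_policy:
  assumes D: "linear_decaying_problem D"
  obtains \<pi> where "\<pi> \<in> policies D"
    "\<And>n s. s \<in> states D \<Longrightarrow> n + snd s = horizon D \<Longrightarrow> J D \<pi> s = opt_value D n s"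
proof -
  let ?Q = "\<lambda>n s A. measure_pmf.expectation (depletion_pmf D s A)
    (\<lambda>X. reward D s X + opt_value D n (next_state s X))"
  \<comment> \<open>At the horizon the truncated subtraction gives index 0, and the maximiser chosen there is an
      arbitrary activity that is never used.\<close>
  have "\<exists>A. A \<in> activities D \<and> opt_value D (Suc (horizon D - snd s - 1)) s =
      ?Q (horizon D - snd s - 1) s A" for s
    using opt_value_Suc_attained[OF D] by metis
  then obtain g where g: "\<And>s. g s \<in> activities D"
    "\<And>s. opt_value D (Suc (horizon D - snd s - 1)) s = ?Q (horizon D - snd s - 1) s (g s)"
    by metis
  define \<pi> where "\<pi> = restrict g (states D)"
  have \<pi>: "\<pi> \<in> policies D"
    using g(1) by (auto simp: \<pi>_def policies_def)
  have "J D \<pi> s = opt_value D n s" if "s \<in> states D" "n + snd s = horizon D" for n s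
    using that
  proof (induction n arbitrary: s)
    case 0
    then show ?case by (simp add: J_at_horizon)
  next
    case (Suc n)
    have n: "horizon D - snd s - 1 = n"
      using Suc.prems(2) by simp
    have "J D \<pi> s = measure_pmf.expectation (depletion_pmf D s (\<pi> s))
        (\<lambda>X. reward D s X + J D \<pi> (next_state s X))"
      using Suc.prems by (intro J_step[OF D \<pi>]) auto
    also have "\<dots> = ?Q n s (\<pi> s)"
    proof (rule expectation_cong_pmf)
      fix X
      show "reward D s X + J D \<pi> (next_state s X) =
          reward D s X + opt_value D n (next_state s X)"
        using Suc.IH[of "next_state s X"] next_state_in_states[of s D X] Suc.prems
        by (simp add: next_state_def)
    qed
    also have "\<dots> = opt_value D (Suc n) s"
      using g(2)[of s] Suc.prems(1) unfolding n by (simp add: \<pi>_def)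
    finally show ?case .
  qed
  with \<pi> show ?thesis by (rule that)
qed

lemma finite_states: "finite (states D)"
proof -
  have "states D \<subseteq> (PiE UNIV (\<lambda>m. {..capacity D m})) \<times> {..horizon D}"
    by (auto simp: states_def)
  then show ?thesis
    by (rule finite_subset) (intro finite_cartesian_product finite_PiE; simp)
qed

lemma J_opt_eq_opt_value:
  assumes D: "linear_decaying_problem D"
    and s: "s \<in> states D" "n + snd s = horizon D"
  shows "J_opt D s = opt_value D n s"
proof -
  obtain \<pi> where \<pi>: "\<pi> \<in> policies D" "J D \<pi> s = opt_value D n s"
    using greedy_policy[OF D] s by metis
  have "finite (policies D)"
    unfolding policies_def
    using D by (intro finite_PiE finite_states) (auto simp: linear_decaying_problem_def)
  then show ?thesis
    unfolding J_opt_def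
    using \<pi> J_le_opt_value[OF D _ s]
    by (intro Max_eqI) (auto intro: rev_image_eqI[OF \<pi>(1)])
qed

theorem lemma3:
  fixes D :: "('m::finite, 'a) depletion_data"
    and s :: "'m state" and \<alpha> :: "'m \<Rightarrow> nat"
  assumes "linear_decaying_problem D"
    and "s \<in> states D"
    and "\<forall>m. \<alpha> m \<in> {0..fst s m}"
  shows "J_opt D s \<le> (\<Sum>m\<in>UNIV. real (\<alpha> m) * weight D m (snd s)) + J_opt D (reduced_state \<alpha> s)"
proof -
  define n where "n = horizon D - snd s"
  have n: "n + snd s = horizon D"
    using assms(2) by (auto simp: n_def states_def)
  have r: "reduced_state \<alpha> s \<in> states D" "n + snd (reduced_state \<alpha> s) = horizon D"
    using assms(2) n
    by (auto simp: states_def reduced_state_def intro: le_trans[OF diff_le_self])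
  show ?thesis
    unfolding J_opt_eq_opt_value[OF assms(1,2) n] J_opt_eq_opt_value[OF assms(1) r]
    using assms(3) by (intro opt_value_le_reduced[OF assms(1) n]) simp
qed

end
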